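(* (Discrete Noether theorem.) Let a Lie group $G$ with Lie algebra $\mathfrak{g}$ act on $Y$ by vertical symmetries such that the smooth discrete Lagrangian $L:\mathcal{B}\to\mathbb{R}$ is invariant under the induced action on $\mathcal{B}$, and let $\mathbb{J}^1,\mathbb{J}^2,\mathbb{J}^3,\mathbb{J}^4:\mathcal{B}\to\mathfrak{g}^*$ be the associated momentum mappings. Let $U\subseteq X=\mathbb{Z}\times\mathbb{Z}$ be a finite regular subset. Then for every solution $\phi\in\mathcal{C}_U$ of the discrete Euler-Lagrange equations on $U$, $$\sum_{(i,j)\in\partial U}\left(\sum_{\square\subseteq U;\ l;\ (i,j)=\square^l}\big[(j^2\phi)^*\mathbb{J}^l\big](\square^1)\right)=0 .$$
   Context: $X=\mathbb{Z}\times\mathbb{Z}=\{(i,j)\}$, $Y=X\times\mathbb{R}$, with fiber $Y_{ij}\cong\mathbb{R}$ over $(i,j)$. A rectangle is an ordered 4-tuple $\square_{ij}=((i,j),(i+1,j),(i+1,j+1),(i,j+1))$; its vertices in order are $\square^1,\square^2,\square^3,\square^4$; $X^\square$ is the set of all rectangles. A point is touched by a rectangle if it is one of its vertices. For $U\subseteq X$: $\square\subseteq U$ means all vertices of $\square$ lie in $U$; $(i,j)$ is an interior point of $U$ if $U$ contains all four rectangles touching $(i,j)$; $\mathrm{int}\,U$ is the set of interior points; $\mathrm{cl}\,U$ is the union of all rectangles touching interior points of $U$; $\partial U=(U\cap\mathrm{cl}\,U)\setminus\mathrm{int}\,U$; $U$ is regular if $U=\mathrm{int}\,U\cup\partial U$.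 $\mathcal{B}=X^\square\times\mathbb{R}^4$, with elements $(\square;y_1,y_2,y_3,y_4)$. $\mathcal{C}_U\cong\mathbb{R}^{|U|}$ is the set of sections $\phi$ of $Y$ over $U$; $j^2\phi(i,j)=(\square_{ij},\phi(\square^1),\phi(\square^2),\phi(\square^3),\phi(\square^4))$ with $\square=\square_{ij}$. A discrete Lagrangian is a function $L:\mathcal{B}\to\mathbb{R}$ (dependence on $\square$ is suppressed in the notation). The discrete Euler-Lagrange equations are: for all $(i,j)\in\mathrm{int}\,U$, $\sum_{l;\square;(i,j)=\square^l}\frac{\partial L}{\partial y_l}(\phi(\square^1),\phi(\square^2),\phi(\square^3),\phi(\square^4))=0$. Group action: $\Phi:G\times Y\to Y$ is vertical, i.e. it preserves each fiber $Y_{ij}$. The induced action on $\mathcal{B}$ is $g\cdot(y_1,y_2,y_3,y_4)=(\Phi(g,y_1),\Phi(g,y_2),\Phi(g,y_3),\Phi(g,y_4))$ (fixing $\square$). For $\xi\in\mathfrak{g}$, $\xi_Y(y)=\frac{d}{dt}|_{t=0}\exp(t\xi)\cdot y$ is the infinitesimal generator, and $\xi_{\mathcal{B}}(y_1,\dots,y_4)=(\xi_Y(y_1),\dots,\xi_Y(y_4))=\sum_{l=1}^4\xi^l_{\mathcal{B}}$, where $\xi_{\mathcal{B}}^l=\xi_Y(y_l)\,\partial/\partial y_l$. With $\Theta_L^l=\frac{\partial L}{\partial y_l}dy_l$ (no sum), set $J^l(\xi)=\mathbf{i}_{\xi_{\mathcal{B}}^l}\Theta_L^l=\frac{\partial L}{\partial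 y_l}\,\xi_Y(y_l)$, a function on $\mathcal{B}$. The momentum mappings $\mathbb{J}^l:\mathcal{B}\to\mathfrak{g}^*$, $l=1,2,3,4$, are defined by $\langle\mathbb{J}^l(y_1,y_2,y_3,y_4),\xi\rangle=J^l(\xi)(y_1,y_2,y_3,y_4)$. The notation $[(j^2\phi)^*f](\square^1)$ means $f$ evaluated at $j^2\phi(\square^1)$. The inner sum runs over all pairs $(\square,l)$ with $\square\subseteq U$ and $\square^l=(i,j)$. *)

theory Defs
  imports "HOL-Analysis.Analysis" "HOL-Algebra.Group_Action" "HOL-Library.Function_Algebras"
begin

section \<open>Smooth manifolds and Lie groups\<close>

text \<open>Being \<open>n\<close> times continuously differentiable on an open set \<open>S\<close>, for maps out of a
  finite-dimensional normed space: the map is differentiable and each of its directional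
  derivatives is \<open>n - 1\<close> times continuously differentiable.\<close>

primrec higher_differentiable_on ::
    "'a::real_normed_vector set \<Rightarrow> ('a \<Rightarrow> 'b::real_normed_vector) \<Rightarrow> nat \<Rightarrow> bool" where
  "higher_differentiable_on S f 0 \<longleftrightarrow> continuous_on S f"
| "higher_differentiable_on S f (Suc n) \<longleftrightarrow>
     (\<forall>x\<in>S. f differentiable (at x)) \<and>
     (\<forall>v. higher_differentiable_on S (\<lambda>x. frechet_derivative f (at x) v) n)"

definition smooth_on :: "'a::real_normed_vector set \<Rightarrow> ('a \<Rightarrow> 'b::real_normed_vector) \<Rightarrow> bool" where
  "smooth_on S f \<longleftrightarrow> (\<forall>n. higher_differentiable_on S f n)"

text \<open>A chart is its domain together with its coordinate map, which is meaningful on the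
  domain only. Atlases need not be maximal.\<close>

type_synonym ('p, 'e) chart = "'p set \<times> ('p \<Rightarrow> 'e)"

record ('p, 'e) manifold =
  mtop :: "'p topology"
  atlas :: "('p, 'e) chart set"

text \<open>The model space is a finite-dimensional normed space rather than one of class
  \<open>euclidean_space\<close>, because the latter excludes dimension 0.\<close>

definition smooth_manifold :: "('p, 'e::real_normed_vector) manifold \<Rightarrow> bool" where
  "smooth_manifold M \<longleftrightarrow>
     (\<exists>B. finite B \<and> span B = (UNIV :: 'e set)) \<and>
     Hausdorff_space (mtop M) \<and> second_countable (mtop M) \<and>
     (\<forall>(D, f) \<in> atlas M. openin (mtop M) D \<and> open (f ` D) \<and>
        homeomorphic_map (subtopology (mtop M) D) (top_of_set (f ` D)) f) \<and>
     (\<Union>(D, f) \<in> atlas M. D) = topspace (mtop M) \<and>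
     (\<forall>(D, f) \<in> atlas M. \<forall>(D', f') \<in> atlas M. smooth_on (f ` (D \<inter> D')) (f' \<circ> inv_into D f))"

definition smooth_map ::
    "('p, 'e::real_normed_vector) manifold \<Rightarrow> ('q, 'f::real_normed_vector) manifold \<Rightarrow>
     ('p \<Rightarrow> 'q) \<Rightarrow> bool" where
  "smooth_map M N F \<longleftrightarrow> continuous_map (mtop M) (mtop N) F \<and>
     (\<forall>(D, f) \<in> atlas M. \<forall>(D', f') \<in> atlas N.
        smooth_on (f ` {p \<in> D. F p \<in> D'}) (f' \<circ> F \<circ> inv_into D f))"

definition model_manifold :: "('e::real_normed_vector, 'e) manifold" where
  "model_manifold = \<lparr>mtop = euclidean, atlas = {(UNIV, id)}\<rparr>"

definition prod_manifold ::
    "('p, 'e) manifold \<Rightarrow> ('q, 'f) manifold \<Rightarrow> ('p \<times> 'q, 'e \<times> 'f) manifold" where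
  "prod_manifold M N = \<lparr>mtop = prod_topology (mtop M) (mtop N),
     atlas = {(D \<times> D', map_prod f f') | D f D' f'. (D, f) \<in> atlas M \<and> (D', f') \<in> atlas N}\<rparr>"

text \<open>The trivial bundle over the discrete set \<open>S\<close> with fibre a normed space.\<close>

definition discrete_bundle :: "'s set \<Rightarrow> ('s \<times> 'e::real_normed_vector, 'e) manifold" where
  "discrete_bundle S = \<lparr>mtop = prod_topology (discrete_topology S) euclidean,
     atlas = {({s} \<times> UNIV, snd) | s. s \<in> S}\<rparr>"

text \<open>A tangent vector at \<open>p\<close> is the family of its coordinate representations in all charts
  around \<open>p\<close>; these transform by the derivatives of the coordinate changes, and the value is
  0 on every other argument. The vector space operations are pointwise.\<close>

definition tangent_space ::
    "('p, 'e::real_normed_vector) manifold \<Rightarrow> 'p \<Rightarrow> (('p, 'e) chart \<Rightarrow> 'e) set" where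
  "tangent_space M p =
     {v. (\<forall>c \<in> atlas M. \<forall>c' \<in> atlas M. p \<in> fst c \<and> p \<in> fst c' \<longrightarrow>
            v c' = frechet_derivative (snd c' \<circ> inv_into (fst c) (snd c)) (at (snd c p)) (v c)) \<and>
         (\<forall>c. \<not> (c \<in> atlas M \<and> p \<in> fst c) \<longrightarrow> v c = 0)}"

definition velocity ::
    "('p, 'e::real_normed_vector) manifold \<Rightarrow> (real \<Rightarrow> 'p) \<Rightarrow> real \<Rightarrow> ('p, 'e) chart \<Rightarrow> 'e" where
  "velocity M \<gamma> t =
     (\<lambda>c. if c \<in> atlas M \<and> \<gamma> t \<in> fst c then vector_derivative (snd c \<circ> \<gamma>) (at t) else 0)"

definition lie_group :: "('g, 'm) monoid_scheme \<Rightarrow> ('g, 'e::real_normed_vector) manifold \<Rightarrow> bool" where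
  "lie_group G M \<longleftrightarrow> group G \<and> smooth_manifold M \<and> topspace (mtop M) = carrier G \<and>
     smooth_map (prod_manifold M M) M (\<lambda>(g, h). g \<otimes>\<^bsub>G\<^esub> h) \<and>
     smooth_map M M (\<lambda>g. inv\<^bsub>G\<^esub> g)"

text \<open>The Lie algebra as a set (the tangent space at the identity); the bracket is not needed.\<close>

definition lie_algebra ::
    "('g, 'm) monoid_scheme \<Rightarrow> ('g, 'e::real_normed_vector) manifold \<Rightarrow> (('g, 'e) chart \<Rightarrow> 'e) set" where
  "lie_algebra G M = tangent_space M \<one>\<^bsub>G\<^esub>"

definition one_parameter_subgroup ::
    "('g, 'm) monoid_scheme \<Rightarrow> ('g, 'e::real_normed_vector) manifold \<Rightarrow> (real \<Rightarrow> 'g) \<Rightarrow> bool" where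
  "one_parameter_subgroup G M \<gamma> \<longleftrightarrow>
     smooth_map model_manifold M \<gamma> \<and> (\<forall>s t. \<gamma> (s + t) = \<gamma> s \<otimes>\<^bsub>G\<^esub> \<gamma> t)"

text \<open>\<open>exp \<xi> = \<gamma>(1)\<close> for the unique one-parameter subgroup \<open>\<gamma>\<close> with \<open>\<gamma>'(0) = \<xi>\<close>. In a Lie group
  such a \<open>\<gamma>\<close> exists for every \<open>\<xi>\<close> in the Lie algebra; the second branch only serves to make the
  function total for other arguments.\<close>

definition lie_exp ::
    "('g, 'm) monoid_scheme \<Rightarrow> ('g, 'e::real_normed_vector) manifold \<Rightarrow> (('g, 'e) chart \<Rightarrow> 'e) \<Rightarrow> 'g" where
  "lie_exp G M \<xi> =
     (if \<exists>\<gamma>. one_parameter_subgroup G M \<gamma> \<and> velocity M \<gamma> 0 = \<xi>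
      then (THE \<gamma>. one_parameter_subgroup G M \<gamma> \<and> velocity M \<gamma> 0 = \<xi>) 1
      else \<one>\<^bsub>G\<^esub>)"


section \<open>Rectangles and regions in the lattice\<close>

type_synonym point = "int \<times> int"
type_synonym rectangle = "point ^ 4"

definition rect :: "point \<Rightarrow> rectangle" where
  "rect = (\<lambda>(i, j). vector [(i, j), (i + 1, j), (i + 1, j + 1), (i, j + 1)])"

lemma rect_nth:
  "rect (i, j) $ 1 = (i, j)"
  "rect (i, j) $ 2 = (i + 1, j)"
  "rect (i, j) $ 3 = (i + 1, j + 1)"
  "rect (i, j) $ 4 = (i, j + 1)"
  by (simp_all add: rect_def vector_def)

definition rectangles :: "rectangle set" where
  "rectangles = range rect"

definition vertices :: "rectangle \<Rightarrow> point set" where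
  "vertices sq = range (\<lambda>l. sq $ l)"

definition lattice_interior :: "point set \<Rightarrow> point set" where
  "lattice_interior U = {x. \<forall>sq \<in> rectangles. x \<in> vertices sq \<longrightarrow> vertices sq \<subseteq> U}"

definition lattice_closure :: "point set \<Rightarrow> point set" where
  "lattice_closure U =
     \<Union> {vertices sq | sq. sq \<in> rectangles \<and> vertices sq \<inter> lattice_interior U \<noteq> {}}"

definition lattice_boundary :: "point set \<Rightarrow> point set" where
  "lattice_boundary U = (U \<inter> lattice_closure U) - lattice_interior U"

definition regular_region :: "point set \<Rightarrow> bool" where
  "regular_region U \<longleftrightarrow> U = lattice_interior U \<union> lattice_boundary U"


section \<open>Discrete field theory\<close>

text \<open>\<open>Y\<close> is the whole type \<open>total_point\<close>; \<open>\<B>\<close> consists of the elements of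
  \<open>jet\<close> whose first component is in \<open>rectangles\<close>.\<close>

type_synonym total_point = "point \<times> real"
type_synonym jet = "rectangle \<times> (real ^ 4)"

definition total_manifold :: "(total_point, real) manifold" where
  "total_manifold = discrete_bundle UNIV"

definition jet_manifold :: "(jet, real ^ 4) manifold" where
  "jet_manifold = discrete_bundle rectangles"

text \<open>A section over \<open>U\<close> is represented by its fibre coordinate.\<close>

definition sections_over :: "point set \<Rightarrow> (point \<Rightarrow> real) set" where
  "sections_over U = U \<rightarrow>\<^sub>E UNIV"

definition j2 :: "(point \<Rightarrow> real) \<Rightarrow> point \<Rightarrow> jet" where
  "j2 \<phi> x = (rect x, \<chi> l. \<phi> (rect x $ l))"

definition partial_y :: "4 \<Rightarrow> (jet \<Rightarrow> real) \<Rightarrow> jet \<Rightarrow> real" where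
  "partial_y l L = (\<lambda>(sq, y). deriv (\<lambda>s. L (sq, \<chi> k. if k = l then s else y $ k)) (y $ l))"

definition discrete_euler_lagrange :: "(jet \<Rightarrow> real) \<Rightarrow> point set \<Rightarrow> (point \<Rightarrow> real) \<Rightarrow> bool" where
  "discrete_euler_lagrange L U \<phi> \<longleftrightarrow>
     (\<forall>x \<in> lattice_interior U.
        (\<Sum>(sq, l) \<in> {(sq, l). sq \<in> rectangles \<and> x = sq $ l}.
           partial_y l L (sq, \<chi> k. \<phi> (sq $ k))) = 0)"

definition vertical_smooth_action ::
    "('g, 'm) monoid_scheme \<Rightarrow> ('g, 'e::real_normed_vector) manifold \<Rightarrow>
     ('g \<Rightarrow> total_point \<Rightarrow> total_point) \<Rightarrow> bool" where
  "vertical_smooth_action G M \<Phi> \<longleftrightarrow>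
     group_action G UNIV \<Phi> \<and>
     smooth_map (prod_manifold M total_manifold) total_manifold (\<lambda>(g, p). \<Phi> g p) \<and>
     (\<forall>g \<in> carrier G. \<forall>p. fst (\<Phi> g p) = fst p)"

definition jet_action :: "('g \<Rightarrow> total_point \<Rightarrow> total_point) \<Rightarrow> 'g \<Rightarrow> jet \<Rightarrow> jet" where
  "jet_action \<Phi> g = (\<lambda>(sq, y). (sq, \<chi> l. snd (\<Phi> g (sq $ l, y $ l))))"

definition invariant_lagrangian ::
    "('g, 'm) monoid_scheme \<Rightarrow> ('g \<Rightarrow> total_point \<Rightarrow> total_point) \<Rightarrow> (jet \<Rightarrow> real) \<Rightarrow> bool" where
  "invariant_lagrangian G \<Phi> L \<longleftrightarrow>
     (\<forall>g \<in> carrier G. \<forall>b \<in> rectangles \<times> UNIV. L (jet_action \<Phi> g b) = L b)"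

text \<open>For a vertical action \<open>\<xi>\<^sub>Y(p)\<close> is tangent to the fibre \<open>\<real>\<close> through \<open>p\<close>, hence a number.\<close>

definition infinitesimal_generator ::
    "('g, 'm) monoid_scheme \<Rightarrow> ('g, 'e::real_normed_vector) manifold \<Rightarrow>
     ('g \<Rightarrow> total_point \<Rightarrow> total_point) \<Rightarrow> (('g, 'e) chart \<Rightarrow> 'e) \<Rightarrow> total_point \<Rightarrow> real" where
  "infinitesimal_generator G M \<Phi> \<xi> p =
     deriv (\<lambda>t. snd (\<Phi> (lie_exp G M (\<lambda>c. t *\<^sub>R \<xi> c)) p)) 0"

text \<open>The functional \<open>\<J>\<^sup>l(b)\<close> on the Lie algebra, extended by 0 outside of it, so that
  equations between functionals are equations between functions.\<close>

definition momentum_map ::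
    "('g, 'm) monoid_scheme \<Rightarrow> ('g, 'e::real_normed_vector) manifold \<Rightarrow>
     ('g \<Rightarrow> total_point \<Rightarrow> total_point) \<Rightarrow> (jet \<Rightarrow> real) \<Rightarrow> 4 \<Rightarrow> jet \<Rightarrow>
     (('g, 'e) chart \<Rightarrow> 'e) \<Rightarrow> real" where
  "momentum_map G M \<Phi> L l b =
     (\<lambda>\<xi>. if \<xi> \<in> lie_algebra G M
          then partial_y l L b * infinitesimal_generator G M \<Phi> \<xi> (fst b $ l, snd b $ l)
          else 0)"

end

theory Submission
  imports Defs
begin

text \<open>Both hypotheses on \<open>L\<close> make a sum of the functions \<open>J\<^sup>l(\<xi>)\<close> vanish. Invariance says that for each
  rectangle the four terms \<open>J\<^sup>l(\<xi>)\<close> add up to \<open>0\<close> (lemma \<open>infinitesimal_invariance\<close>). The discrete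
  Euler-Lagrange equation, multiplied by \<open>\<xi>\<^sub>Y\<close> at an interior point, says that for this point the four
  terms of the rectangles touching it add up to \<open>0\<close>. The terms of all rectangles in \<open>U\<close> therefore have
  total \<open>0\<close> when grouped by rectangles; grouped by points (lemma \<open>sum_over_vertices\<close>) the interior
  contributes \<open>0\<close>, and by regularity what remains is the sum over the boundary.

  The analytic work lies in infinitesimal invariance. The chain rule for
  \<open>t \<mapsto> L(exp (t \<xi>) \<cdot> b)\<close> requires that \<open>exp (t \<xi>) \<cdot> p\<close> is differentiable in \<open>t\<close>, that is, that
  \<open>t \<mapsto> lie_exp G M (t \<xi>)\<close> is a smooth one-parameter subgroup (lemma
  \<open>lie_exp_scaleR_one_parameter_subgroup\<close>). As \<open>lie_exp\<close> is defined by a definite description, this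
  rests on the uniqueness of the one-parameter subgroup with a given initial velocity (lemma
  \<open>one_parameter_subgroup_unique\<close>), which follows from the group law and connectedness of the real
  line.\<close>

section \<open>Curves and smooth maps in charts\<close>

lemma smooth_on_imp_differentiable:
  assumes "smooth_on S f" "x \<in> S"
  shows "f differentiable (at x)"
  using assms higher_differentiable_on.simps(2)[of S f 0] unfolding smooth_on_def by blast

lemma atlasD:
  assumes "smooth_manifold M" "(D, f) \<in> atlas M"
  shows "openin (mtop M) D" "inj_on f D"
proof -
  have *: "openin (mtop M) D \<and> homeomorphic_map (subtopology (mtop M) D) (top_of_set (f ` D)) f"
    using assms unfolding smooth_manifold_def by fast
  then show "openin (mtop M) D" by simp
  have "topspace (mtop M) \<inter> D = D"
    using * openin_subset by blast
  then show "inj_on f D"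
    using * homeomorphic_imp_injective_map by fastforce
qed

lemma chart_around:
  assumes "smooth_manifold M" "p \<in> topspace (mtop M)"
  obtains D f where "(D, f) \<in> atlas M" "p \<in> D"
proof -
  have "(\<Union>(D, f) \<in> atlas M. D) = topspace (mtop M)"
    using assms(1) by (simp add: smooth_manifold_def)
  then have "p \<in> (\<Union>(D, f) \<in> atlas M. D)"
    using assms(2) by simp
  then show thesis using that by auto
qed

lemma open_chart_domain_along_curve:
  fixes \<alpha> :: "real \<Rightarrow> 'p"
  assumes "continuous_map euclidean (mtop M) \<alpha>" "smooth_manifold M" "(D, f) \<in> atlas M"
  shows "open {s. \<alpha> s \<in> D}"
  using openin_continuous_map_preimage[OF assms(1) atlasD(1)[OF assms(2,3)]] by simp

text \<open>The chain rule for a curve followed by a smooth map, in coordinates. The derivative is the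
  value at \<open>u\<close> of a linear map that depends on the point but not on the curve, so two curves
  with the same tangent at the same point have images with the same tangent.\<close>
lemma has_vector_derivative_smooth_map:
  fixes \<alpha> :: "real \<Rightarrow> 'p"
  assumes F: "smooth_map M N F"
    and chart: "(D, f) \<in> atlas M" "(D', f') \<in> atlas N"
    and inj: "inj_on f D"
    and op: "open {s. \<alpha> s \<in> D}"
    and dom: "\<alpha> t \<in> D" "F (\<alpha> t) \<in> D'"
    and deriv: "((f \<circ> \<alpha>) has_vector_derivative u) (at t)"
  shows "((f' \<circ> F \<circ> \<alpha>) has_vector_derivative
            frechet_derivative (f' \<circ> F \<circ> inv_into D f) (at (f (\<alpha> t))) u) (at t)"
proof -
  let ?P = "f' \<circ> F \<circ> inv_into D f"
  have "smooth_on (f ` {p \<in> D. F p \<in> D'}) ?P"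
    using F chart unfolding smooth_map_def by fast
  then have "?P differentiable (at (f (\<alpha> t)))"
    using dom by (intro smooth_on_imp_differentiable) auto
  then have P: "(?P has_derivative frechet_derivative ?P (at (f (\<alpha> t)))) (at ((f \<circ> \<alpha>) t))"
    by (simp add: frechet_derivative_works)
  have "((?P \<circ> (f \<circ> \<alpha>)) has_vector_derivative frechet_derivative ?P (at (f (\<alpha> t))) u) (at t)"
    by (rule vector_derivative_diff_chain_within[OF deriv has_derivative_at_withinI[OF P]])
  then show ?thesis
    by (rule has_vector_derivative_transform_within_open[OF _ op]) (use dom inj in auto)
qed

section \<open>Rescaling one-parameter subgroups\<close>

text \<open>For open \<open>S\<close> only, since the derivatives at a point depend on the values nearby.\<close>
lemma higher_differentiable_on_cong:
  assumes "open S" "higher_differentiable_on S f n" "\<And>x. x \<in> S \<Longrightarrow> g x = f x"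
  shows "higher_differentiable_on S g n"
  using assms(2,3)
proof (induction n arbitrary: f g)
  case 0
  then show ?case by (simp cong: continuous_on_cong)
next
  case (Suc n)
  have d: "(g has_derivative frechet_derivative f (at x)) (at x)" if "x \<in> S" for x
    using Suc.prems that assms(1) has_derivative_transform_within_open[of f _ x UNIV S g]
    by (auto simp: frechet_derivative_works)
  have "frechet_derivative g (at x) = frechet_derivative f (at x)" if "x \<in> S" for x
    using frechet_derivative_at[OF d[OF that]] by simp
  note eq = this
  have "higher_differentiable_on S (\<lambda>x. frechet_derivative g (at x) v) n" for v
    by (rule Suc.IH[of "\<lambda>x. frechet_derivative f (at x) v"]) (use eq Suc.prems(1) in simp_all)
  moreover have "\<forall>x\<in>S. g differentiable (at x)"
    using d unfolding differentiable_def by blast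
  ultimately show ?case by simp
qed

text \<open>Differentiating \<open>s \<mapsto> f (c s)\<close> in direction \<open>v\<close> amounts to differentiating \<open>f\<close> in direction
  \<open>c v\<close>, so the induction hypothesis applies to that directional derivative of \<open>f\<close>.\<close>
lemma higher_differentiable_on_rescale:
  fixes f :: "real \<Rightarrow> 'b::real_normed_vector"
  assumes "open S" "higher_differentiable_on S f n"
  shows "higher_differentiable_on ((*) c -` S) (\<lambda>s. f (c * s)) n"
  using assms(2)
proof (induction n arbitrary: f)
  case 0
  then show ?case
    by (auto intro!: continuous_on_compose2[of S f] continuous_intros)
next
  case (Suc n)
  have der: "((\<lambda>s. f (c * s)) has_derivative (\<lambda>v. frechet_derivative f (at (c * x)) (c * v))) (at x)"
    if "c * x \<in> S" for x
  proof -
    have "(f has_derivative frechet_derivative f (at (c * x))) (at (c * x))"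
      using Suc.prems that by (auto simp: frechet_derivative_works)
    from has_derivative_compose[of "(*) c" "(*) c" x UNIV, OF _ this] show ?thesis
      by (simp add: has_derivative_mult_right)
  qed
  have op: "open ((*) c -` S)"
    using assms(1) by (intro open_vimage continuous_intros)
  show ?case unfolding higher_differentiable_on.simps
  proof (intro conjI ballI allI)
    fix x assume "x \<in> (*) c -` S"
    then show "(\<lambda>s. f (c * s)) differentiable (at x)"
      using der by (auto simp: differentiable_def)
  next
    fix v
    have "higher_differentiable_on ((*) c -` S) (\<lambda>s. frechet_derivative f (at (c * s)) (c * v)) n"
      by (rule Suc.IH[of "\<lambda>x. frechet_derivative f (at x) (c * v)"]) (use Suc.prems in simp)
    then show "higher_differentiable_on ((*) c -` S) (\<lambda>x. frechet_derivative (\<lambda>s. f (c * s)) (at x) v) n"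
      by (rule higher_differentiable_on_cong[OF op]) (simp add: frechet_derivative_at[OF der, symmetric])
  qed
qed

lemma smooth_curveD:
  assumes "smooth_map model_manifold M \<gamma>"
  shows "continuous_map euclidean (mtop M) \<gamma>"
    "(D, f) \<in> atlas M \<Longrightarrow> smooth_on {t. \<gamma> t \<in> D} (f \<circ> \<gamma>)"
proof -
  have id: "inv_into UNIV (id :: 'b \<Rightarrow> 'b) = id" by (simp add: fun_eq_iff inv_f_eq)
  show "continuous_map euclidean (mtop M) \<gamma>"
    "(D, f) \<in> atlas M \<Longrightarrow> smooth_on {t. \<gamma> t \<in> D} (f \<circ> \<gamma>)"
    using assms by (fastforce simp: smooth_map_def model_manifold_def id)+
qed

lemma has_vector_derivative_velocity:
  assumes "smooth_map model_manifold M \<gamma>" "(D, f) \<in> atlas M" "\<gamma> t \<in> D"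
  shows "((f \<circ> \<gamma>) has_vector_derivative velocity M \<gamma> t (D, f)) (at t)"
proof -
  have "(f \<circ> \<gamma>) differentiable (at t)"
    using smooth_on_imp_differentiable[OF smooth_curveD(2)[OF assms(1,2)]] assms(3) by simp
  then show ?thesis
    using assms by (simp add: velocity_def vector_derivative_works)
qed

text \<open>This relates \<open>exp (c \<xi>)\<close> to \<open>exp \<xi>\<close>; the case \<open>c = - 1\<close> is used in the uniqueness proof.\<close>
lemma one_parameter_subgroup_rescale:
  fixes M :: "('g, 'e::real_normed_vector) manifold"
  assumes "smooth_manifold M" "one_parameter_subgroup G M \<gamma>"
  shows "one_parameter_subgroup G M (\<lambda>s. \<gamma> (c * s))"
    "velocity M (\<lambda>s. \<gamma> (c * s)) 0 = (\<lambda>k. c *\<^sub>R velocity M \<gamma> 0 k)"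
proof -
  have sm: "smooth_map model_manifold M \<gamma>" and add: "\<And>s t. \<gamma> (s + t) = \<gamma> s \<otimes>\<^bsub>G\<^esub> \<gamma> t"
    using assms(2) by (auto simp: one_parameter_subgroup_def)
  note cont = smooth_curveD(1)[OF sm]
  have "continuous_map euclidean (mtop M) (\<gamma> \<circ> (*) c)"
    by (rule continuous_map_compose[OF _ cont]) (simp add: continuous_intros)
  moreover have "smooth_on {t. \<gamma> (c * t) \<in> D} (\<lambda>s. f (\<gamma> (c * s)))" if "(D, f) \<in> atlas M" for D f
    using higher_differentiable_on_rescale[OF open_chart_domain_along_curve[OF cont assms(1) that],
        of "f \<circ> \<gamma>"] smooth_curveD(2)[OF sm that]
    by (simp add: smooth_on_def vimage_def)
  moreover have "inv_into UNIV (id :: real \<Rightarrow> real) = id" by (simp add: fun_eq_iff inv_f_eq)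
  ultimately have "smooth_map model_manifold M (\<lambda>s. \<gamma> (c * s))"
    by (auto simp: smooth_map_def model_manifold_def o_def)
  then show "one_parameter_subgroup G M (\<lambda>s. \<gamma> (c * s))"
    by (simp add: one_parameter_subgroup_def add distrib_left)
  show "velocity M (\<lambda>s. \<gamma> (c * s)) 0 = (\<lambda>k. c *\<^sub>R velocity M \<gamma> 0 k)"
  proof
    fix k :: "('g, 'e) chart"
    obtain D f where k: "k = (D, f)" by fastforce
    show "velocity M (\<lambda>s. \<gamma> (c * s)) 0 k = c *\<^sub>R velocity M \<gamma> 0 k"
    proof (cases "k \<in> atlas M \<and> \<gamma> 0 \<in> D")
      case True
      then have d: "((f \<circ> \<gamma>) has_vector_derivative velocity M \<gamma> 0 k) (at (c * 0))"
        using has_vector_derivative_velocity[OF sm] k by simp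
      have "((*) c has_vector_derivative c) (at 0)"
        using has_vector_derivative_mult_right[OF has_vector_derivative_id] by simp
      from vector_diff_chain_at[OF this d]
      have "((f \<circ> \<gamma> \<circ> (*) c) has_vector_derivative c *\<^sub>R velocity M \<gamma> 0 k) (at 0)" .
      then have "vector_derivative (f \<circ> \<gamma> \<circ> (*) c) (at 0) = c *\<^sub>R velocity M \<gamma> 0 k"
        by (rule vector_derivative_at)
      with True k show ?thesis by (simp add: velocity_def o_def)
    qed (auto simp: velocity_def k)
  qed
qed

section \<open>Uniqueness of one-parameter subgroups\<close>

lemma lie_groupD:
  assumes "lie_group G M"
  shows "group G" "smooth_manifold M" "topspace (mtop M) = carrier G"
    "smooth_map (prod_manifold M M) M (\<lambda>(g, h). g \<otimes>\<^bsub>G\<^esub> h)"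
  using assms by (auto simp: lie_group_def)

lemma one_parameter_subgroup_carrier:
  assumes "lie_group G M" "one_parameter_subgroup G M \<gamma>"
  shows "\<gamma> t \<in> carrier G"
  using continuous_map_image_subset_topspace[OF smooth_curveD(1)] assms
  by (fastforce simp: one_parameter_subgroup_def lie_groupD(3))

lemma one_parameter_subgroup_zero:
  assumes "lie_group G M" "one_parameter_subgroup G M \<gamma>"
  shows "\<gamma> 0 = \<one>\<^bsub>G\<^esub>"
proof -
  interpret group G using lie_groupD(1)[OF assms(1)] .
  have "\<gamma> 0 \<otimes>\<^bsub>G\<^esub> \<gamma> 0 = \<gamma> 0"
    using assms(2) unfolding one_parameter_subgroup_def by (metis add_0)
  then show ?thesis
    using one_parameter_subgroup_carrier[OF assms] by (simp add: l_cancel_one)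
qed

lemma one_parameter_subgroup_minus:
  assumes "lie_group G M" "one_parameter_subgroup G M \<gamma>"
  shows "\<gamma> t \<otimes>\<^bsub>G\<^esub> \<gamma> (- t) = \<one>\<^bsub>G\<^esub>"
  using one_parameter_subgroup_zero[OF assms] assms(2) unfolding one_parameter_subgroup_def
  by (metis add.right_inverse)

lemma one_parameter_subgroup_const:
  fixes M :: "('g, 'e::real_normed_vector) manifold"
  assumes "lie_group G M"
  shows "one_parameter_subgroup G M (\<lambda>_::real. \<one>\<^bsub>G\<^esub>)"
proof -
  interpret group G using lie_groupD(1)[OF assms] .
  have "higher_differentiable_on S (\<lambda>_. c) n" for S :: "real set" and c :: 'e and n
    by (induction n arbitrary: c) (auto simp: frechet_derivative_const)
  then have "smooth_map model_manifold M (\<lambda>_::real. \<one>\<^bsub>G\<^esub>)"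
    by (auto simp: smooth_map_def model_manifold_def smooth_on_def o_def lie_groupD(3)[OF assms])
  then show ?thesis by (simp add: one_parameter_subgroup_def)
qed

lemma continuous_map_lie_mult:
  fixes \<alpha> \<beta> :: "real \<Rightarrow> 'g"
  assumes "lie_group G M" "continuous_map euclidean (mtop M) \<alpha>" "continuous_map euclidean (mtop M) \<beta>"
  shows "continuous_map euclidean (mtop M) (\<lambda>s. \<alpha> s \<otimes>\<^bsub>G\<^esub> \<beta> s)"
proof -
  have "continuous_map (prod_topology (mtop M) (mtop M)) (mtop M) (\<lambda>(g, h). g \<otimes>\<^bsub>G\<^esub> h)"
    using lie_groupD(4)[OF assms(1)] by (simp add: smooth_map_def prod_manifold_def)
  from continuous_map_compose[OF continuous_map_pairedI[OF assms(2,3)] this]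
  show ?thesis by (simp add: o_def)
qed

lemma has_vector_derivative_lie_mult:
  fixes \<alpha> \<beta> :: "real \<Rightarrow> 'g"
  assumes G: "lie_group G M"
    and \<alpha>: "continuous_map euclidean (mtop M) \<alpha>" "(D1, f1) \<in> atlas M" "\<alpha> t \<in> D1"
      "((f1 \<circ> \<alpha>) has_vector_derivative u) (at t)"
    and \<beta>: "continuous_map euclidean (mtop M) \<beta>" "(D2, f2) \<in> atlas M" "\<beta> t \<in> D2"
      "((f2 \<circ> \<beta>) has_vector_derivative v) (at t)"
    and f: "(D, f) \<in> atlas M" "\<alpha> t \<otimes>\<^bsub>G\<^esub> \<beta> t \<in> D"
  shows "((\<lambda>s. f (\<alpha> s \<otimes>\<^bsub>G\<^esub> \<beta> s)) has_vector_derivative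
           frechet_derivative (f \<circ> (\<lambda>(g, h). g \<otimes>\<^bsub>G\<^esub> h) \<circ> inv_into (D1 \<times> D2) (map_prod f1 f2))
             (at (f1 (\<alpha> t), f2 (\<beta> t))) (u, v)) (at t)"
proof -
  note man = lie_groupD(2)[OF G]
  let ?c = "\<lambda>s. (\<alpha> s, \<beta> s)"
  have chart: "(D1 \<times> D2, map_prod f1 f2) \<in> atlas (prod_manifold M M)"
    using \<alpha> \<beta> by (auto simp: prod_manifold_def)
  have inj: "inj_on (map_prod f1 f2) (D1 \<times> D2)"
    using \<alpha> \<beta> atlasD(2)[OF man] by (blast intro: map_prod_inj_on)
  have "{s. ?c s \<in> D1 \<times> D2} = {s. \<alpha> s \<in> D1} \<inter> {s. \<beta> s \<in> D2}" by auto
  then have op: "open {s. ?c s \<in> D1 \<times> D2}"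
    using open_chart_domain_along_curve[OF _ man] \<alpha> \<beta> by auto
  have "((\<lambda>s. (f1 (\<alpha> s), f2 (\<beta> s))) has_vector_derivative (u, v)) (at t)"
    using \<alpha>(4) \<beta>(4) by (auto intro: has_vector_derivative_Pair simp: o_def)
  then have "((map_prod f1 f2 \<circ> ?c) has_vector_derivative (u, v)) (at t)"
    by (simp add: o_def)
  from has_vector_derivative_smooth_map[OF lie_groupD(4)[OF G] chart f(1) inj op _ _ this]
  show ?thesis using \<alpha> \<beta> f by (simp add: o_def case_prod_unfold)
qed

text \<open>The tangent of a product of curves depends linearly on the pair of their tangents.\<close>
lemma zero_derivative_lie_mult:
  fixes \<alpha> \<beta> :: "real \<Rightarrow> 'g"
  assumes G: "lie_group G M"
    and \<alpha>: "continuous_map euclidean (mtop M) \<alpha>" "(D1, f1) \<in> atlas M" "\<alpha> t \<in> D1"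
      "((f1 \<circ> \<alpha>) has_vector_derivative 0) (at t)"
    and \<beta>: "continuous_map euclidean (mtop M) \<beta>" "(D2, f2) \<in> atlas M" "\<beta> t \<in> D2"
      "((f2 \<circ> \<beta>) has_vector_derivative 0) (at t)"
    and f: "(D, f) \<in> atlas M" "\<alpha> t \<otimes>\<^bsub>G\<^esub> \<beta> t \<in> D"
  shows "((\<lambda>s. f (\<alpha> s \<otimes>\<^bsub>G\<^esub> \<beta> s)) has_vector_derivative 0) (at t)"
proof -
  let ?m = "\<lambda>(g, h). g \<otimes>\<^bsub>G\<^esub> h"
  let ?P = "f \<circ> ?m \<circ> inv_into (D1 \<times> D2) (map_prod f1 f2)"
  let ?x = "(f1 (\<alpha> t), f2 (\<beta> t))"
  have chart: "(D1 \<times> D2, map_prod f1 f2) \<in> atlas (prod_manifold M M)"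
    using \<alpha>(2) \<beta>(2) by (auto simp: prod_manifold_def)
  have "smooth_on (map_prod f1 f2 ` {p \<in> D1 \<times> D2. ?m p \<in> D}) ?P"
    using lie_groupD(4)[OF G] chart f(1) unfolding smooth_map_def by fast
  moreover have "?x \<in> map_prod f1 f2 ` {p \<in> D1 \<times> D2. ?m p \<in> D}"
    using \<alpha>(3) \<beta>(3) f(2) by (auto intro!: rev_image_eqI[of "(\<alpha> t, \<beta> t)"])
  ultimately have "?P differentiable (at ?x)"
    by (rule smooth_on_imp_differentiable)
  then have "frechet_derivative ?P (at ?x) 0 = 0"
    by (rule linear_0[OF linear_frechet_derivative])
  then show ?thesis
    using has_vector_derivative_lie_mult[OF G \<alpha> \<beta> f] by (simp add: zero_prod_def)
qed

text \<open>A translate of a stationary curve is stationary: multiplication by a fixed group element is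
  multiplication by a constant curve.\<close>
lemma zero_derivative_translate:
  fixes \<alpha> :: "real \<Rightarrow> 'g"
  assumes G: "lie_group G M"
    and \<alpha>: "continuous_map euclidean (mtop M) \<alpha>" "(D, f) \<in> atlas M" "\<alpha> t \<in> D"
      "((f \<circ> \<alpha>) has_vector_derivative 0) (at t)"
    and gh: "g \<in> carrier G" "h \<in> carrier G"
    and f': "(D', f') \<in> atlas M" "g \<otimes>\<^bsub>G\<^esub> (\<alpha> t \<otimes>\<^bsub>G\<^esub> h) \<in> D'"
  shows "((\<lambda>s. f' (g \<otimes>\<^bsub>G\<^esub> (\<alpha> s \<otimes>\<^bsub>G\<^esub> h))) has_vector_derivative 0) (at t)"
proof -
  interpret group G using lie_groupD(1)[OF G] .
  note man = lie_groupD(2)[OF G] and carr = lie_groupD(3)[OF G]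
  have const: "continuous_map euclidean (mtop M) (\<lambda>_::real. x)" if "x \<in> carrier G" for x
    using that carr by simp
  note zero = zero_derivative_lie_mult[OF G]
  have mem: "\<alpha> t \<in> carrier G"
    using continuous_map_image_subset_topspace[OF \<alpha>(1)] carr by auto
  obtain D2 f2 where 2: "(D2, f2) \<in> atlas M" "h \<in> D2"
    using chart_around[OF man, of h] gh carr by auto
  obtain D1 f1 where 1: "(D1, f1) \<in> atlas M" "g \<in> D1"
    using chart_around[OF man, of g] gh carr by auto
  obtain D3 f3 where 3: "(D3, f3) \<in> atlas M" "\<alpha> t \<otimes>\<^bsub>G\<^esub> h \<in> D3"
    using chart_around[OF man, of "\<alpha> t \<otimes>\<^bsub>G\<^esub> h"] gh mem carr by auto
  have "((\<lambda>s. f3 (\<alpha> s \<otimes>\<^bsub>G\<^esub> h)) has_vector_derivative 0) (at t)"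
    by (rule zero[OF \<alpha> const[OF gh(2)] 2 _ 3]) (simp add: o_def)
  then show ?thesis
    by (intro zero[OF const[OF gh(1)] 1 _ continuous_map_lie_mult[OF G \<alpha>(1) const[OF gh(2)]] 3 _ f'])
       (simp_all add: o_def)
qed

text \<open>In each chart the curve is locally constant, and the real line is connected.\<close>
lemma zero_velocity_imp_constant:
  fixes \<alpha> :: "real \<Rightarrow> 'p"
  assumes man: "smooth_manifold M" and cont: "continuous_map euclidean (mtop M) \<alpha>"
    and zero: "\<And>D f t. (D, f) \<in> atlas M \<Longrightarrow> \<alpha> t \<in> D \<Longrightarrow> ((f \<circ> \<alpha>) has_vector_derivative 0) (at t)"
  shows "\<alpha> s = \<alpha> t"
proof -
  have "\<alpha> constant_on UNIV"
  proof (rule locally_constant_imp_constant)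
    fix a :: real
    have "\<alpha> a \<in> topspace (mtop M)"
      using continuous_map_image_subset_topspace[OF cont] by auto
    then obtain D f where Df: "(D, f) \<in> atlas M" "\<alpha> a \<in> D"
      using chart_around[OF man] by blast
    obtain e where e: "e > 0" "ball a e \<subseteq> {s. \<alpha> s \<in> D}"
      using open_chart_domain_along_curve[OF cont man Df(1)] Df(2) openE by blast
    have const: "\<alpha> x = \<alpha> a" if "x \<in> ball a e" for x
    proof -
      have "((f \<circ> \<alpha>) has_derivative (\<lambda>h. 0)) (at y within ball a e)" if "y \<in> ball a e" for y
      proof -
        have "((f \<circ> \<alpha>) has_vector_derivative 0) (at y)"
          using zero[OF Df(1), of y] e that by blast
        then show ?thesis
          by (simp add: has_vector_derivative_def has_derivative_at_withinI)
      qed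
      from has_derivative_zero_constant[OF convex_ball this]
      obtain c where "\<forall>y\<in>ball a e. (f \<circ> \<alpha>) y = c" by auto
      then have "f (\<alpha> x) = f (\<alpha> a)" using that e by simp
      moreover have "\<alpha> x \<in> D" using e(2) that by blast
      ultimately show ?thesis
        using inj_onD[OF atlasD(2)[OF man Df(1)]] Df(2) by blast
    qed
    have "openin (top_of_set UNIV) (ball a e) \<and> a \<in> ball a e" using e(1) by simp
    with const show "\<exists>T. openin (top_of_set UNIV) T \<and> a \<in> T \<and> (\<forall>x\<in>T. \<alpha> x = \<alpha> a)"
      by blast
  qed simp
  then show ?thesis unfolding constant_on_def by (metis UNIV_I)
qed

text \<open>Instead of solving a differential equation, consider \<open>\<alpha>(s) = \<gamma>(s) \<delta>(-s)\<close>. At \<open>s = 0\<close> the pair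
  \<open>(\<gamma>(s), \<delta>(-s))\<close> has the same tangent as \<open>(\<gamma>(s), \<gamma>(-s))\<close>, whose product is constantly \<open>1\<close>, so
  \<open>\<alpha>\<close> is stationary at \<open>0\<close>. Since \<open>\<alpha>(r + s) = \<gamma>(r) \<alpha>(s) \<delta>(-r)\<close>, it is then stationary everywhere,
  hence constantly \<open>1\<close>.\<close>
lemma one_parameter_subgroup_unique:
  assumes G: "lie_group G M"
    and \<gamma>: "one_parameter_subgroup G M \<gamma>" and \<delta>: "one_parameter_subgroup G M \<delta>"
    and eq: "velocity M \<gamma> 0 = velocity M \<delta> 0"
  shows "\<gamma> = \<delta>"
proof
  fix t
  interpret group G using lie_groupD(1)[OF G] .
  note man = lie_groupD(2)[OF G] and carr = lie_groupD(3)[OF G]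
  note in_G [simp] = one_parameter_subgroup_carrier[OF G \<gamma>] one_parameter_subgroup_carrier[OF G \<delta>]
  note at_0 [simp] = one_parameter_subgroup_zero[OF G \<gamma>] one_parameter_subgroup_zero[OF G \<delta>]
  have add: "\<gamma> (s + t) = \<gamma> s \<otimes>\<^bsub>G\<^esub> \<gamma> t" "\<delta> (s + t) = \<delta> s \<otimes>\<^bsub>G\<^esub> \<delta> t" for s t
    using \<gamma> \<delta> by (auto simp: one_parameter_subgroup_def)
  have sm: "smooth_map model_manifold M \<gamma>" using \<gamma> by (simp add: one_parameter_subgroup_def)
  note cont_\<gamma> = smooth_curveD(1)[OF sm]
  have rev: "continuous_map euclidean (mtop M) (\<lambda>s. \<beta> (- s))"
       "(D, f) \<in> atlas M \<Longrightarrow> \<beta> 0 \<in> D \<Longrightarrow>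
          ((f \<circ> (\<lambda>s. \<beta> (- s))) has_vector_derivative - velocity M \<beta> 0 (D, f)) (at 0)"
    if "one_parameter_subgroup G M \<beta>" for \<beta> D f
  proof -
    note r = one_parameter_subgroup_rescale[OF man that, of "-1"]
    then have sm': "smooth_map model_manifold M (\<lambda>s. \<beta> (- s))"
      by (simp add: one_parameter_subgroup_def)
    then show "continuous_map euclidean (mtop M) (\<lambda>s. \<beta> (- s))"
      by (rule smooth_curveD(1))
    show "((f \<circ> (\<lambda>s. \<beta> (- s))) has_vector_derivative - velocity M \<beta> 0 (D, f)) (at 0)"
      if "(D, f) \<in> atlas M" "\<beta> 0 \<in> D"
      using has_vector_derivative_velocity[OF sm' that(1), of 0] that r(2) by simp
  qed
  define \<alpha> where "\<alpha> s = \<gamma> s \<otimes>\<^bsub>G\<^esub> \<delta> (- s)" for s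
  have [simp]: "\<alpha> s \<in> carrier G" for s by (simp add: \<alpha>_def)
  have \<alpha>0: "\<alpha> 0 = \<one>\<^bsub>G\<^esub>" by (simp add: \<alpha>_def)
  have cont: "continuous_map euclidean (mtop M) \<alpha>"
    unfolding \<alpha>_def by (rule continuous_map_lie_mult[OF G cont_\<gamma> rev(1)[OF \<delta>]])
  obtain D f where Df: "(D, f) \<in> atlas M" "\<one>\<^bsub>G\<^esub> \<in> D"
    using chart_around[OF man, of "\<one>\<^bsub>G\<^esub>"] carr by auto
  \<comment> \<open>The velocity \<open>?u\<close> and the tangent \<open>?dm\<close> are common to the products with \<open>\<delta>\<close> and with \<open>\<gamma>\<close>.\<close>
  have "((f \<circ> \<alpha>) has_vector_derivative 0) (at 0)"
  proof -
    let ?u = "velocity M \<gamma> 0 (D, f)"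
    let ?dm = "frechet_derivative (f \<circ> (\<lambda>(g, h). g \<otimes>\<^bsub>G\<^esub> h) \<circ> inv_into (D \<times> D) (map_prod f f))
                 (at (f \<one>\<^bsub>G\<^esub>, f \<one>\<^bsub>G\<^esub>)) (?u, - ?u)"
    have d\<gamma>: "((f \<circ> \<gamma>) has_vector_derivative ?u) (at 0)"
      using has_vector_derivative_velocity[OF sm Df(1), of 0] Df(2) by simp
    have dm: "((\<lambda>s. f (\<gamma> s \<otimes>\<^bsub>G\<^esub> \<beta> (- s))) has_vector_derivative ?dm) (at 0)"
      if \<beta>: "one_parameter_subgroup G M \<beta>" and v: "velocity M \<beta> 0 = velocity M \<gamma> 0" for \<beta>
      using has_vector_derivative_lie_mult[OF G cont_\<gamma> Df(1) _ d\<gamma> rev(1)[OF \<beta>] Df(1) _ _ Df(1)]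
        rev(2)[OF \<beta> Df(1)] Df(2) v one_parameter_subgroup_zero[OF G \<beta>] by simp
    have "((\<lambda>s. f \<one>\<^bsub>G\<^esub>) has_vector_derivative ?dm) (at (0::real))"
      using dm[OF \<gamma>] by (simp add: one_parameter_subgroup_minus[OF G \<gamma>])
    then have "?dm = 0"
      using vector_derivative_unique_at[OF _ has_vector_derivative_const] by blast
    then show ?thesis using dm[OF \<delta>] eq by (simp add: \<alpha>_def o_def)
  qed
  note zero_at_0 = this
  have "((f' \<circ> \<alpha>) has_vector_derivative 0) (at r)" if "(D', f') \<in> atlas M" "\<alpha> r \<in> D'" for D' f' r
  proof -
    have shift: "\<gamma> r \<otimes>\<^bsub>G\<^esub> (\<alpha> s \<otimes>\<^bsub>G\<^esub> \<delta> (- r)) = \<alpha> (r + s)" for s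
    proof -
      have "\<delta> (- (r + s)) = \<delta> (- s) \<otimes>\<^bsub>G\<^esub> \<delta> (- r)"
        using add(2)[of "- s" "- r"] by (simp add: algebra_simps)
      then show ?thesis unfolding \<alpha>_def add(1) by (simp add: m_assoc)
    qed
    have "\<gamma> r \<otimes>\<^bsub>G\<^esub> (\<alpha> 0 \<otimes>\<^bsub>G\<^esub> \<delta> (- r)) \<in> D'"
      using that(2) shift[of 0] by simp
    from zero_derivative_translate[OF G cont Df(1) _ zero_at_0 in_G(1) in_G(2) that(1) this]
    have "((\<lambda>s. f' (\<alpha> (r + s))) has_vector_derivative 0) (at 0)"
      using Df(2) \<alpha>0 by (simp add: shift)
    then have *: "((\<lambda>s. f' (\<alpha> (r + s))) has_vector_derivative 0) (at (r - r))" by simp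
    have "((\<lambda>s. s - r) has_vector_derivative 1) (at r)"
      by (auto intro!: derivative_eq_intros simp: has_vector_derivative_def)
    from vector_diff_chain_at[OF this *] show ?thesis by (simp add: o_def)
  qed
  then have "\<alpha> t = \<one>\<^bsub>G\<^esub>"
    using zero_velocity_imp_constant[OF man cont] \<alpha>0 by metis
  then have "\<gamma> t \<otimes>\<^bsub>G\<^esub> \<delta> (- t) = \<delta> t \<otimes>\<^bsub>G\<^esub> \<delta> (- t)"
    by (simp add: \<alpha>_def one_parameter_subgroup_minus[OF G \<delta>])
  then show "\<gamma> t = \<delta> t" by simp
qed

section \<open>The exponential map along a line\<close>

lemma lie_exp_eq:
  assumes "lie_group G M" "one_parameter_subgroup G M \<gamma>" "velocity M \<gamma> 0 = \<xi>"
  shows "lie_exp G M \<xi> = \<gamma> 1"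
proof -
  have "(THE \<delta>. one_parameter_subgroup G M \<delta> \<and> velocity M \<delta> 0 = \<xi>) = \<gamma>"
    using assms by (blast intro: one_parameter_subgroup_unique)
  then show ?thesis using assms unfolding lie_exp_def by auto
qed

text \<open>If no one-parameter subgroup has velocity \<open>\<xi>\<close>, then none has velocity \<open>t \<xi>\<close> for \<open>t \<noteq> 0\<close>, by
  rescaling; so \<open>lie_exp\<close> takes its default value along the whole line through \<open>\<xi>\<close> and the constant
  subgroup is as required. This treats all \<open>\<xi>\<close> without an existence theorem for the
  exponential map.\<close>
lemma lie_exp_scaleR_one_parameter_subgroup:
  assumes G: "lie_group G M"
  obtains \<gamma> where "one_parameter_subgroup G M \<gamma>" "\<And>t. lie_exp G M (\<lambda>c. t *\<^sub>R \<xi> c) = \<gamma> t"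
proof (cases "\<exists>\<gamma>. one_parameter_subgroup G M \<gamma> \<and> velocity M \<gamma> 0 = \<xi>")
  case True
  then obtain \<gamma> where \<gamma>: "one_parameter_subgroup G M \<gamma>" "velocity M \<gamma> 0 = \<xi>" by blast
  have "lie_exp G M (\<lambda>c. t *\<^sub>R \<xi> c) = \<gamma> t" for t
    using lie_exp_eq[OF G one_parameter_subgroup_rescale[OF lie_groupD(2)[OF G] \<gamma>(1), of t]]
    by (simp add: \<gamma>(2))
  then show thesis using \<gamma>(1) that by blast
next
  case False
  have "lie_exp G M (\<lambda>c. t *\<^sub>R \<xi> c) = \<one>\<^bsub>G\<^esub>" for t
  proof (cases "\<exists>\<gamma>. one_parameter_subgroup G M \<gamma> \<and> velocity M \<gamma> 0 = (\<lambda>c. t *\<^sub>R \<xi> c)")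
    case True
    then obtain \<gamma> where \<gamma>: "one_parameter_subgroup G M \<gamma>" "velocity M \<gamma> 0 = (\<lambda>c. t *\<^sub>R \<xi> c)"
      by blast
    note rescale = one_parameter_subgroup_rescale[OF lie_groupD(2)[OF G]]
    have "t = 0"
    proof (rule ccontr)
      assume "t \<noteq> 0"
      then have "velocity M (\<lambda>s. \<gamma> (inverse t * s)) 0 = \<xi>"
        using rescale(2)[OF \<gamma>(1), of "inverse t"] \<gamma>(2) by simp
      then show False using False rescale(1)[OF \<gamma>(1)] by blast
    qed
    \<comment> \<open>At \<open>t = 0\<close> the constant curve, written as a rescaling, represents the zero vector.\<close>
    then have "velocity M (\<lambda>s. \<gamma> (0 * s)) 0 = (\<lambda>c. t *\<^sub>R \<xi> c)"
      using rescale(2)[OF \<gamma>(1), of 0] by simp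
    from lie_exp_eq[OF G rescale(1)[OF \<gamma>(1)] this] show ?thesis
      using one_parameter_subgroup_zero[OF G \<gamma>(1)] by simp
  next
    case False
    then show ?thesis unfolding lie_exp_def by (rule if_not_P)
  qed
  then show thesis using one_parameter_subgroup_const[OF G] that by blast
qed

section \<open>Infinitesimal invariance of the Lagrangian\<close>

lemma vertical_smooth_action_one:
  assumes "lie_group G M" "vertical_smooth_action G M \<Phi>"
  shows "\<Phi> \<one>\<^bsub>G\<^esub> p = p"
proof -
  have "group_action G UNIV \<Phi>"
    using assms(2) by (simp add: vertical_smooth_action_def)
  from group_action.id_eq_one[OF this] show ?thesis
    by (metis UNIV_I restrict_apply')
qed

text \<open>The infinitesimal generator is defined by \<open>deriv\<close>, which says nothing unless the derivative
  exists. It exists because \<open>exp (t \<xi>)\<close> is a smooth curve in \<open>t\<close>.\<close>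
lemma has_real_derivative_lie_exp_action:
  fixes M :: "('g, 'e::real_normed_vector) manifold"
  assumes G: "lie_group G M" and \<Phi>: "vertical_smooth_action G M \<Phi>"
  shows "((\<lambda>t. snd (\<Phi> (lie_exp G M (\<lambda>c. t *\<^sub>R \<xi> c)) p)) has_real_derivative
           infinitesimal_generator G M \<Phi> \<xi> p) (at 0)"
proof -
  obtain \<gamma> where \<gamma>: "one_parameter_subgroup G M \<gamma>" "\<And>t. lie_exp G M (\<lambda>c. t *\<^sub>R \<xi> c) = \<gamma> t"
    using lie_exp_scaleR_one_parameter_subgroup[OF G] by blast
  note man = lie_groupD(2)[OF G]
  have sm: "smooth_map model_manifold M \<gamma>"
    using \<gamma>(1) by (simp add: one_parameter_subgroup_def)
  have \<gamma>0: "\<gamma> 0 \<in> topspace (mtop M)"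
    using one_parameter_subgroup_carrier[OF G \<gamma>(1)] by (simp add: lie_groupD(3)[OF G])
  obtain D f where Df: "(D, f) \<in> atlas M" "\<gamma> 0 \<in> D"
    by (rule chart_around[OF man \<gamma>0])
  obtain x y where p: "p = (x, y)" by fastforce
  let ?F = "\<lambda>(g, p). \<Phi> g p"
  let ?\<alpha> = "\<lambda>t. (\<gamma> t, p)"
  have F: "smooth_map (prod_manifold M total_manifold) total_manifold ?F"
    using \<Phi> by (simp add: vertical_smooth_action_def)
  have fibre: "({x} \<times> UNIV, snd) \<in> atlas total_manifold"
    unfolding total_manifold_def discrete_bundle_def by simp (metis surj_pair)
  have chart: "(D \<times> ({x} \<times> UNIV), map_prod f snd) \<in> atlas (prod_manifold M total_manifold)"
    using Df(1) fibre by (auto simp: prod_manifold_def)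
  have inj: "inj_on (map_prod f snd) (D \<times> ({x} \<times> UNIV))"
    by (rule map_prod_inj_on[OF atlasD(2)[OF man Df(1)]]) (auto simp: inj_on_def)
  have op: "open {t. ?\<alpha> t \<in> D \<times> ({x} \<times> UNIV)}"
    using open_chart_domain_along_curve[OF smooth_curveD(1)[OF sm] man Df(1)] by (simp add: p)
  have deriv: "((map_prod f snd \<circ> ?\<alpha>) has_vector_derivative (velocity M \<gamma> 0 (D, f), 0)) (at 0)"
    using has_vector_derivative_Pair[OF has_vector_derivative_velocity[OF sm Df(1), of 0]
        has_vector_derivative_const] Df(2)
    by (simp add: o_def)
  have "fst (\<Phi> (\<gamma> 0) p) = x"
    using \<Phi> one_parameter_subgroup_carrier[OF G \<gamma>(1)]
    unfolding vertical_smooth_action_def p by (metis fst_conv)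
  then have "?F (?\<alpha> 0) \<in> {x} \<times> UNIV"
    by (simp add: mem_Times_iff)
  from has_vector_derivative_smooth_map[OF F chart fibre inj op _ this deriv] Df(2)
  obtain w where "((snd \<circ> ?F \<circ> ?\<alpha>) has_vector_derivative w) (at 0)"
    by (auto simp: p)
  then have w: "((\<lambda>t. snd (\<Phi> (\<gamma> t) p)) has_real_derivative w) (at 0)"
    by (simp add: has_real_derivative_iff_has_vector_derivative o_def)
  show ?thesis
    using w DERIV_imp_deriv[OF w] by (simp add: infinitesimal_generator_def \<gamma>(2))
qed

lemma has_derivative_lagrangian:
  assumes L: "smooth_map jet_manifold model_manifold L" and sq: "sq \<in> rectangles"
  shows "((\<lambda>y. L (sq, y)) has_derivative (\<lambda>w. \<Sum>l\<in>UNIV. partial_y l L (sq, y) * w $ l)) (at y)"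
proof -
  let ?P = "\<lambda>y. L (sq, y)"
  let ?c = "{sq} \<times> (UNIV :: (real ^ 4) set)"
  have inv: "inv_into ?c snd y = (sq, y)" for y
    by (rule inv_into_f_eq) (auto simp: inj_on_def)
  have "(?c, snd) \<in> atlas jet_manifold"
    using sq by (auto simp: jet_manifold_def discrete_bundle_def)
  moreover have "(UNIV, id) \<in> atlas (model_manifold :: (real, real) manifold)"
    by (simp add: model_manifold_def)
  ultimately have "smooth_on (snd ` {p \<in> ?c. L p \<in> UNIV}) (id \<circ> L \<circ> inv_into ?c snd)"
    using L unfolding smooth_map_def by blast
  moreover have "id \<circ> L \<circ> inv_into ?c snd = ?P"
    by (simp add: fun_eq_iff inv)
  ultimately have "?P differentiable (at y)"
    by (intro smooth_on_imp_differentiable) auto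
  then obtain P' where P': "(?P has_derivative P') (at y)"
    by (auto simp: differentiable_def)
  have axis: "P' (axis l 1) = partial_y l L (sq, y)" for l
  proof -
    \<comment> \<open>The curve in the definition of \<open>partial_y\<close> is a line in a coordinate direction.\<close>
    have line: "(\<chi> k. if k = l then s else y $ k) = y + (s - y $ l) *\<^sub>R axis l 1" for s
      by (simp add: vec_eq_iff axis_def)
    have "((\<lambda>s. y + (s - y $ l) *\<^sub>R axis l 1) has_vector_derivative axis l 1) (at (y $ l))"
      by (auto intro!: derivative_eq_intros simp: has_vector_derivative_def)
    from vector_derivative_diff_chain_within[OF this, of ?P P']
    have "((\<lambda>s. ?P (y + (s - y $ l) *\<^sub>R axis l 1)) has_vector_derivative P' (axis l 1)) (at (y $ l))"
      using P' by (simp add: o_def has_derivative_at_withinI)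
    then have "((\<lambda>s. L (sq, \<chi> k. if k = l then s else y $ k)) has_real_derivative P' (axis l 1)) (at (y $ l))"
      by (simp add: line has_real_derivative_iff_has_vector_derivative)
    from DERIV_imp_deriv[OF this] show ?thesis by (simp add: partial_y_def)
  qed
  have "P' w = (\<Sum>l\<in>UNIV. partial_y l L (sq, y) * w $ l)" for w
  proof -
    have lin: "linear P'" by (rule has_derivative_linear[OF P'])
    have "P' w = P' (\<Sum>l\<in>UNIV. w $ l *\<^sub>R axis l 1)"
      using basis_expansion[of w] by (simp add: scalar_mult_eq_scaleR)
    also have "\<dots> = (\<Sum>l\<in>UNIV. partial_y l L (sq, y) * w $ l)"
      by (simp add: linear_sum[OF lin] linear_scale[OF lin] axis mult.commute)
    finally show ?thesis .
  qed
  then have "P' = (\<lambda>w. \<Sum>l\<in>UNIV. partial_y l L (sq, y) * w $ l)"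
    by blast
  with P' show ?thesis by simp
qed

text \<open>Differentiate \<open>L(exp (t \<xi>) \<cdot> b) = L(b)\<close> at \<open>t = 0\<close>. This is the identity
  \<open>\<J>\<^sup>1 + \<J>\<^sup>2 + \<J>\<^sup>3 + \<J>\<^sup>4 = 0\<close> evaluated at \<open>\<xi>\<close>.\<close>
lemma infinitesimal_invariance:
  assumes G: "lie_group G M" and \<Phi>: "vertical_smooth_action G M \<Phi>"
    and L: "smooth_map jet_manifold model_manifold L" and inv: "invariant_lagrangian G \<Phi> L"
    and sq: "sq \<in> rectangles"
  shows "(\<Sum>l\<in>UNIV. partial_y l L (sq, y) * infinitesimal_generator G M \<Phi> \<xi> (sq $ l, y $ l)) = 0"
proof -
  let ?e = "\<lambda>t. lie_exp G M (\<lambda>c. t *\<^sub>R \<xi> c)"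
  let ?gen = "\<lambda>l. infinitesimal_generator G M \<Phi> \<xi> (sq $ l, y $ l)"
  let ?c = "\<lambda>t. \<chi> l. snd (\<Phi> (?e t) (sq $ l, y $ l))"
  obtain \<gamma> where \<gamma>: "one_parameter_subgroup G M \<gamma>" "\<And>t. ?e t = \<gamma> t"
    using lie_exp_scaleR_one_parameter_subgroup[OF G] by blast
  have c0: "?c 0 = y"
    using vertical_smooth_action_one[OF G \<Phi>] one_parameter_subgroup_zero[OF G \<gamma>(1)] \<gamma>(2)[of 0]
    by (simp add: vec_eq_iff)
  have const: "L (sq, ?c t) = L (sq, y)" for t
  proof -
    have "?e t \<in> carrier G"
      unfolding \<gamma>(2) by (rule one_parameter_subgroup_carrier[OF G \<gamma>(1)])
    then have "L (jet_action \<Phi> (?e t) (sq, y)) = L (sq, y)"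
      using inv sq unfolding invariant_lagrangian_def by blast
    then show ?thesis by (simp add: jet_action_def)
  qed
  have "((\<lambda>t. snd (\<Phi> (?e t) (sq $ l, y $ l)) *\<^sub>R (axis l 1 :: real ^ 4))
          has_vector_derivative ?gen l *\<^sub>R axis l 1) (at 0)" for l
    using has_vector_derivative_scaleR[OF has_real_derivative_lie_exp_action[OF G \<Phi>]
        has_vector_derivative_const] by simp
  then have "((\<lambda>t. \<Sum>l\<in>UNIV. snd (\<Phi> (?e t) (sq $ l, y $ l)) *\<^sub>R (axis l 1 :: real ^ 4))
          has_vector_derivative (\<Sum>l\<in>UNIV. ?gen l *\<^sub>R axis l 1)) (at 0)"
    by (intro has_vector_derivative_sum)
  moreover have expand: "(\<Sum>l\<in>UNIV. a l *\<^sub>R axis l 1) = (\<chi> l. a l)" for a :: "4 \<Rightarrow> real"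
    using basis_expansion[of "\<chi> l. a l"] by (simp add: scalar_mult_eq_scaleR)
  ultimately have c: "(?c has_vector_derivative (\<chi> l. ?gen l)) (at 0)"
    by simp
  from vector_derivative_diff_chain_within[OF c, of "\<lambda>y. L (sq, y)", unfolded c0,
      OF has_derivative_at_withinI[OF has_derivative_lagrangian[OF L sq]]]
  have "((\<lambda>t. L (sq, y)) has_vector_derivative (\<Sum>l\<in>UNIV. partial_y l L (sq, y) * ?gen l)) (at (0::real))"
    by (simp add: o_def const)
  from vector_derivative_unique_at[OF this has_vector_derivative_const] show ?thesis .
qed

section \<open>Summation over the lattice\<close>

lemma sum_fun_apply: "(\<Sum>x\<in>A. f x) y = (\<Sum>x\<in>A. f x y)"
  for f :: "'i \<Rightarrow> 'a \<Rightarrow> 'b::comm_monoid_add"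
  by (induction A rule: infinite_finite_induct) auto

lemma rect_first_vertex: "sq \<in> rectangles \<Longrightarrow> rect (sq $ 1) = sq"
  by (auto simp: rectangles_def rect_nth)

text \<open>Double counting: the incidences of a rectangle in \<open>U\<close> with a point of \<open>U\<close> are grouped by
  points on the left and by rectangles on the right.\<close>
lemma sum_over_vertices:
  fixes J :: "rectangle \<Rightarrow> 4 \<Rightarrow> 'b::comm_monoid_add"
  assumes "finite U"
  shows "(\<Sum>x\<in>U. \<Sum>(sq, l)\<in>{(sq, l). sq \<in> rectangles \<and> vertices sq \<subseteq> U \<and> x = sq $ l}. J sq l) =
         (\<Sum>sq\<in>{sq \<in> rectangles. vertices sq \<subseteq> U}. \<Sum>l\<in>UNIV. J sq l)"
proof -
  let ?A = "{sq \<in> rectangles. vertices sq \<subseteq> U}"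
  have "sq \<in> rect ` U" if "sq \<in> ?A" for sq
  proof (rule image_eqI)
    show "sq = rect (sq $ 1)" using that by (simp add: rect_first_vertex)
    show "sq $ 1 \<in> U" using that by (auto simp: vertices_def)
  qed
  then have "?A \<subseteq> rect ` U" by blast
  then have fin: "finite ?A"
    using assms finite_surj by blast
  have "(\<Sum>x\<in>U. \<Sum>(sq, l)\<in>{(sq, l). sq \<in> rectangles \<and> vertices sq \<subseteq> U \<and> x = sq $ l}. J sq l) =
        (\<Sum>x\<in>U. \<Sum>(sq, l)\<in>{p. p \<in> ?A \<times> UNIV \<and> (\<lambda>(sq, l). sq $ l) p = x}. J sq l)"
    by (intro sum.cong refl) auto
  also have "\<dots> = (\<Sum>(sq, l)\<in>?A \<times> UNIV. J sq l)"
    by (rule sum.group) (use fin assms in \<open>auto simp: vertices_def\<close>)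
  also have "\<dots> = (\<Sum>sq\<in>?A. \<Sum>l\<in>UNIV. J sq l)"
    by (rule sum.cartesian_product[symmetric])
  finally show ?thesis .
qed

theorem mainTheorem6:
  fixes G :: "('g, 'm) monoid_scheme"
    and M :: "('g, 'e::real_normed_vector) manifold"
    and \<Phi> :: "'g \<Rightarrow> total_point \<Rightarrow> total_point"
    and L :: "jet \<Rightarrow> real"
    and U :: "point set"
    and \<phi> :: "point \<Rightarrow> real"
  assumes "lie_group G M"
    and "vertical_smooth_action G M \<Phi>"
    and "smooth_map jet_manifold model_manifold L"
    and "invariant_lagrangian G \<Phi> L"
    and "finite U"
    and "regular_region U"
    and "\<phi> \<in> sections_over U"
    and "discrete_euler_lagrange L U \<phi>"
  shows "(\<Sum>x \<in> lattice_boundary U.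
            \<Sum>(sq, l) \<in> {(sq, l). sq \<in> rectangles \<and> vertices sq \<subseteq> U \<and> x = sq $ l}.
              momentum_map G M \<Phi> L l (j2 \<phi> (sq $ 1))) = 0"
proof
  fix \<xi>
  let ?I = "\<lambda>x. {(sq, l). sq \<in> rectangles \<and> vertices sq \<subseteq> U \<and> x = sq $ l}"
  let ?gen = "\<lambda>x. infinitesimal_generator G M \<Phi> \<xi> (x, \<phi> x)"
  define J where "J sq l = momentum_map G M \<Phi> L l (j2 \<phi> (sq $ 1)) \<xi>" for sq :: rectangle and l
  have J: "J sq l = partial_y l L (sq, \<chi> k. \<phi> (sq $ k)) * ?gen (sq $ l)"
    if "\<xi> \<in> lie_algebra G M" "sq \<in> rectangles" for sq l
    using that by (simp add: J_def momentum_map_def j2_def rect_first_vertex)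
  have "(\<Sum>x\<in>lattice_boundary U. \<Sum>(sq, l)\<in>?I x. J sq l) = 0"
  proof (cases "\<xi> \<in> lie_algebra G M")
    case False
    then show ?thesis by (simp add: J_def momentum_map_def)
  next
    case True
    have U: "U = lattice_interior U \<union> lattice_boundary U"
      "lattice_interior U \<inter> lattice_boundary U = {}"
      using \<open>regular_region U\<close> by (auto simp: regular_region_def lattice_boundary_def)
    have fin: "finite (lattice_interior U)" "finite (lattice_boundary U)"
      using U(1) \<open>finite U\<close> by (metis finite_Un)+
    have "(\<Sum>l\<in>UNIV. J sq l) = 0" if "sq \<in> rectangles" for sq
      using infinitesimal_invariance[OF assms(1-4) that, of "\<chi> k. \<phi> (sq $ k)" \<xi>]
      by (simp add: J[OF True that])
    then have total: "(\<Sum>x\<in>U. \<Sum>(sq, l)\<in>?I x. J sq l) = 0"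
      unfolding sum_over_vertices[OF \<open>finite U\<close>] by (intro sum.neutral) blast
    have interior: "(\<Sum>(sq, l)\<in>?I x. J sq l) = 0" if x: "x \<in> lattice_interior U" for x
    proof -
      let ?E = "{(sq, l). sq \<in> rectangles \<and> x = sq $ l}"
      \<comment> \<open>All four rectangles touching an interior point lie in \<open>U\<close>, and \<open>\<xi>\<^sub>Y\<close> at that point is
        a common factor; what remains is the discrete Euler-Lagrange equation.\<close>
      have "?I x = ?E"
        using x unfolding lattice_interior_def vertices_def by blast
      then have "(\<Sum>(sq, l)\<in>?I x. J sq l) =
          (\<Sum>(sq, l)\<in>?E. partial_y l L (sq, \<chi> k. \<phi> (sq $ k)) * ?gen x)"
        by (auto intro!: sum.cong simp: J[OF True])
      also have "\<dots> = (\<Sum>(sq, l)\<in>?E. partial_y l L (sq, \<chi> k. \<phi> (sq $ k))) * ?gen x"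
        by (simp add: sum_distrib_right case_prod_unfold)
      also have "\<dots> = 0"
        using \<open>discrete_euler_lagrange L U \<phi>\<close> x by (simp add: discrete_euler_lagrange_def)
      finally show ?thesis .
    qed
    have "(\<Sum>x\<in>U. \<Sum>(sq, l)\<in>?I x. J sq l) =
        (\<Sum>x\<in>lattice_interior U. \<Sum>(sq, l)\<in>?I x. J sq l) +
        (\<Sum>x\<in>lattice_boundary U. \<Sum>(sq, l)\<in>?I x. J sq l)"
      using sum.union_disjoint[OF fin U(2), of "\<lambda>x. \<Sum>(sq, l)\<in>?I x. J sq l"]
      unfolding U(1)[symmetric] .
    then show ?thesis using total interior by simp
  qed
  then show "(\<Sum>x\<in>lattice_boundary U. \<Sum>(sq, l)\<in>?I x. momentum_map G M \<Phi> L l (j2 \<phi> (sq $ 1))) \<xi>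
      = 0 \<xi>"
    by (simp add: sum_fun_apply J_def case_prod_unfold)
qed

end
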